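(* Let $(X,d)$ be a complete metric space, let $\kappa$ be an $e^{0}$-distance on $X$, and let $T:X\to\mathcal{C}(X)$ be a multivalued mapping. Suppose that: (S1) there exists an $\mathcal{MT}$-function $\mu:[0,\infty)\to[0,1)$ such that for each $x\in X$, if $y\in Tx$ with $y\neq x$, then there exists $z\in Ty$ such that $$\kappa(y,z)\leq\mu(\kappa(x,y))\,\kappa(x,y);$$ (S2) $T$ further satisfies one of the following conditions: (H1) $T$ is closed; (H2) the function $f:X\to[0,\infty)$ defined by $f(x)=\kappa(x,Tx)$ is lower semicontinuous; (H3) the function $g:X\to[0,\infty)$ defined by $g(x)=d(x,Tx)$ is lower semicontinuous; (H4) for any sequence $\{x_n\}$ in $X$ with $x_{n+1}\in Tx_n$ for all $n\in\mathbb{N}$ and $\lim_{n\to\infty}x_n=v$, we have $\lim_{n\to\infty}\kappa(x_n,Tv)=0$; (H5) $\inf\{\kappa(x,z)+\kappa(x,Tx):x\in X\}>0$ for every $z\in X$ with $z\notin\mathcal{F}(T)$. Then $\mathcal{F}(T)\neq\emptyset$.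
   Context: For a metric space $(X,d)$, $\mathcal{C}(X)$ denotes the class of all nonempty closed subsets of $X$. For a multivalued mapping $T$ on $X$, $\mathcal{F}(T)=\{v\in X: v\in Tv\}$ is its set of fixed points, and $T$ is closed if its graph $\{(x,y)\in X\times X:y\in Tx\}$ is closed in $X\times X$. A function $\kappa:X\times X\to[0,+\infty)$ is an $e$-distance (essential distance) on $(X,d)$ if: ($\tau1$) $\kappa(x,z)\leq\kappa(x,y)+\kappa(y,z)$ for all $x,y,z\in X$; ($\tau2$) if $x\in X$ and $\{y_n\}$ is a sequence in $X$ with $\lim_{n\to\infty}y_n=y$ such that $\kappa(x,y_n)\leq M$ for all $n$, for some $M=M(x)>0$, then $\kappa(x,y)\leq M$; ($\tau3$) for any sequence $\{x_n\}$ in $X$ with $\lim_{n\to\infty}\sup\{\kappa(x_n,x_m):m>n\}=0$, if there exists a sequence $\{y_n\}$ in $X$ such that $\lim_{n\to\infty}\kappa(x_n,y_n)=0$, then $\lim_{n\to\infty}d(x_n,y_n)=0$. Limits of sequences in $X$ and lower semicontinuity are with respect to $d$; $\kappa$ is not assumed symmetric. An $e^{0}$-distance is an $e$-distance $\kappa$ with $\kappa(x,x)=0$ for all $x\in X$. For $x\in X$ and nonempty $C\subseteq X$, $\kappa(x,C)=\inf_{y\in C}\kappa(x,y)$ and $d(x,C)=\inf_{y\in C}d(x,y)$. A function $\mu:[0,\infty)\to[0,1)$ is an $\mathcal{MT}$-function if $\limsup_{s\to t^{+}}\mu(s)<1$ for all $t\in[0,\infty)$. *)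

theory Defs
  imports "HOL-Analysis.Analysis"
begin

text \<open>
  The supremum in the third condition is taken in the extended reals, where it is defined
  also for unbounded sets.
\<close>
definition e_distance :: "('a::metric_space \<Rightarrow> 'a \<Rightarrow> real) \<Rightarrow> bool" where
  "e_distance \<kappa> \<longleftrightarrow>
     (\<forall>x y. 0 \<le> \<kappa> x y) \<and>
     (\<forall>x y z. \<kappa> x z \<le> \<kappa> x y + \<kappa> y z) \<and>
     (\<forall>x y (Y :: nat \<Rightarrow> 'a) M. M > 0 \<longrightarrow> Y \<longlonglongrightarrow> y \<longrightarrow> (\<forall>n. \<kappa> x (Y n) \<le> M) \<longrightarrow> \<kappa> x y \<le> M) \<and>
     (\<forall>X Y :: nat \<Rightarrow> 'a.
        (\<lambda>n. SUP m\<in>{n<..}. ereal (\<kappa> (X n) (X m))) \<longlonglongrightarrow> 0 \<longrightarrow>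
        (\<lambda>n. \<kappa> (X n) (Y n)) \<longlonglongrightarrow> 0 \<longrightarrow>
        (\<lambda>n. dist (X n) (Y n)) \<longlonglongrightarrow> 0)"

definition e0_distance :: "('a::metric_space \<Rightarrow> 'a \<Rightarrow> real) \<Rightarrow> bool" where
  "e0_distance \<kappa> \<longleftrightarrow> e_distance \<kappa> \<and> (\<forall>x. \<kappa> x x = 0)"

text \<open>
  For nonempty \<open>C\<close> and nonnegative \<open>\<kappa>\<close> this infimum is over a nonempty set bounded below by 0.
  For \<open>\<kappa> = dist\<close> it is the library's \<open>infdist\<close>.
\<close>
definition kdist :: "('a \<Rightarrow> 'a \<Rightarrow> real) \<Rightarrow> 'a \<Rightarrow> 'a set \<Rightarrow> real" where
  "kdist \<kappa> x C = (INF y\<in>C. \<kappa> x y)"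

text \<open>Only the values of \<open>\<mu>\<close> on \<open>[0, \<infinity>)\<close> matter; \<open>at_right t\<close> excludes \<open>t\<close> itself.\<close>
definition MT_function :: "(real \<Rightarrow> real) \<Rightarrow> bool" where
  "MT_function \<mu> \<longleftrightarrow>
     (\<forall>t\<ge>0. 0 \<le> \<mu> t \<and> \<mu> t < 1) \<and>
     (\<forall>t\<ge>0. Limsup (at_right t) (\<lambda>s. ereal (\<mu> s)) < 1)"

definition fixed_points :: "('a \<Rightarrow> 'a set) \<Rightarrow> 'a set" where
  "fixed_points T = {v. v \<in> T v}"

definition closed_multimap :: "('a::topological_space \<Rightarrow> 'a set) \<Rightarrow> bool" where
  "closed_multimap T \<longleftrightarrow> closed {(x, y). y \<in> T x}"

text \<open>At an isolated point the filter \<open>at x\<close> is trivial and the condition holds.\<close>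
definition lower_semicontinuous :: "('a::topological_space \<Rightarrow> real) \<Rightarrow> bool" where
  "lower_semicontinuous f \<longleftrightarrow> (\<forall>x. ereal (f x) \<le> Liminf (at x) (\<lambda>y. ereal (f y)))"

end

theory Submission
  imports Defs
begin

text \<open>
  If \<open>T\<close> had no fixed point, the contraction hypothesis could be applied at every step of an orbit
  \<open>x\<^sub>n\<^sub>+\<^sub>1 \<in> T x\<^sub>n\<close>, since the successive points never coincide. The step lengths
  \<open>a n = \<kappa> (x n) (x (n + 1))\<close> then satisfy \<open>a (n + 1) \<le> \<mu> (a n) * a n\<close>, so they decrease to
  a limit \<open>t\<close>. An \<open>MT\<close>-function is bounded away from 1 on some interval \<open>[t, t + \<delta>)\<close>, hence the
  decay is geometric (\<open>MT_contraction_geometric\<close>) and so is that of \<open>\<kappa> (x n) (x m)\<close> for \<open>m > n\<close>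
  (\<open>geometric_steps_tail\<close>).

  The third axiom of an \<open>e\<close>-distance turns such \<open>\<kappa>\<close>-tails into an ordinary Cauchy property
  (\<open>e_distance_Cauchy\<close>), and the second one shows that the limit \<open>v\<close> is also approached in \<open>\<kappa>\<close>, that
  is \<open>\<kappa> (x n) v \<longlonglongrightarrow> 0\<close>. Each of the five regularity conditions then places \<open>v\<close> in \<open>T v\<close>:
  closedness of the graph directly, since \<open>(x n, x (n + 1)) \<longlonglongrightarrow> (v, v)\<close>; lower semicontinuity of
  either distance function because its values along the orbit are at most the step lengths, in \<open>\<kappa>\<close>
  or in the metric, and so vanish in the limit; the infimum condition because both \<open>\<kappa> (x n) v\<close>
  and \<open>\<kappa> (x n) (T (x n)) \<le> a n\<close> tend to 0, which makes the infimum for \<open>z = v\<close> vanish. The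
  condition on sequences, and lower semicontinuity of \<open>\<kappa> x (T x)\<close>, yield only that the orbit
  approaches \<open>T v\<close> in \<open>\<kappa>\<close>; the third axiom, used once more, converts this into metric closeness
  (\<open>kdist_orbit_imp_mem\<close>).
\<close>

section \<open>Essential distances\<close>

lemma e_distance_nonneg: "e_distance \<kappa> \<Longrightarrow> 0 \<le> \<kappa> x y"
  by (simp add: e_distance_def)

lemma e_distance_triangle: "e_distance \<kappa> \<Longrightarrow> \<kappa> x z \<le> \<kappa> x y + \<kappa> y z"
  by (simp add: e_distance_def)

lemma e_distance_limit_le:
  assumes "e_distance \<kappa>" "M > 0" "Y \<longlonglongrightarrow> y" "\<And>n. \<kappa> x (Y n) \<le> M"
  shows "\<kappa> x y \<le> M"
  using assms unfolding e_distance_def by blast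

text \<open>
  A real null sequence dominating the tails replaces the extended-real supremum of the third axiom,
  which it bounds from above.
\<close>
lemma e_distance_dist_tendsto_0:
  fixes X Y :: "nat \<Rightarrow> 'a::metric_space"
  assumes \<kappa>: "e_distance \<kappa>"
    and tail: "\<And>n m. n < m \<Longrightarrow> \<kappa> (X n) (X m) \<le> \<gamma> n"
    and \<gamma>: "\<gamma> \<longlonglongrightarrow> 0"
    and XY: "(\<lambda>n. \<kappa> (X n) (Y n)) \<longlonglongrightarrow> 0"
  shows "(\<lambda>n. dist (X n) (Y n)) \<longlonglongrightarrow> 0"
proof -
  have "(\<lambda>n. SUP m\<in>{n<..}. ereal (\<kappa> (X n) (X m))) \<longlonglongrightarrow> 0"
  proof (rule tendsto_sandwich)
    have "0 \<le> (SUP m\<in>{n<..}. ereal (\<kappa> (X n) (X m)))" for n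
      by (rule SUP_upper2[of "Suc n"]) (auto simp: e_distance_nonneg[OF \<kappa>])
    then show "\<forall>\<^sub>F n in sequentially. 0 \<le> (SUP m\<in>{n<..}. ereal (\<kappa> (X n) (X m)))"
      by simp
    have "(SUP m\<in>{n<..}. ereal (\<kappa> (X n) (X m))) \<le> ereal (\<gamma> n)" for n
      by (rule SUP_least) (auto simp: tail)
    then show "\<forall>\<^sub>F n in sequentially. (SUP m\<in>{n<..}. ereal (\<kappa> (X n) (X m))) \<le> ereal (\<gamma> n)"
      by simp
    show "(\<lambda>n. ereal (\<gamma> n)) \<longlonglongrightarrow> 0"
      using \<gamma> by (simp add: zero_ereal_def)
  qed simp
  with \<kappa> XY show ?thesis
    unfolding e_distance_def by blast
qed

text \<open>
  The auxiliary sequence of the third axiom may be any selection of later terms. Selecting, whenever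
  there is one, a later term at distance at least \<open>\<epsilon>\<close> shows that from some index on there is none.
\<close>
lemma e_distance_Cauchy:
  fixes X :: "nat \<Rightarrow> 'a::metric_space"
  assumes \<kappa>: "e_distance \<kappa>"
    and tail: "\<And>n m. n < m \<Longrightarrow> \<kappa> (X n) (X m) \<le> \<gamma> n"
    and \<gamma>: "\<gamma> \<longlonglongrightarrow> 0"
  shows "Cauchy X"
proof (rule metric_CauchyI)
  fix \<epsilon> :: real
  assume "\<epsilon> > 0"
  have "\<exists>m>n. (\<exists>k>n. dist (X n) (X k) \<ge> \<epsilon>) \<longrightarrow> dist (X n) (X m) \<ge> \<epsilon>" for n
    by blast
  then obtain s where s_gt: "\<And>n. s n > n"
    and s_far: "\<And>n k. \<lbrakk>k > n; dist (X n) (X k) \<ge> \<epsilon>\<rbrakk> \<Longrightarrow> dist (X n) (X (s n)) \<ge> \<epsilon>"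
    by metis
  have "(\<lambda>n. \<kappa> (X n) (X (s n))) \<longlonglongrightarrow> 0"
    by (rule tendsto_sandwich[OF _ _ tendsto_const \<gamma>])
      (auto simp: e_distance_nonneg[OF \<kappa>] tail s_gt)
  then have "(\<lambda>n. dist (X n) (X (s n))) \<longlonglongrightarrow> 0"
    by (intro e_distance_dist_tendsto_0[OF \<kappa> _ \<gamma>] tail)
  then have "\<forall>\<^sub>F n in sequentially. dist (X n) (X (s n)) < \<epsilon>"
    using \<open>\<epsilon> > 0\<close> by (simp add: order_tendstoD)
  then obtain N where N: "\<And>n. n \<ge> N \<Longrightarrow> dist (X n) (X (s n)) < \<epsilon>"
    by (auto simp: eventually_sequentially)
  have later: "dist (X n) (X m) < \<epsilon>" if "n \<ge> N" "m > n" for m n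
    using N[of n] s_far[of n m] that by fastforce
  have "dist (X m) (X n) < \<epsilon>" if "m \<ge> N" "n \<ge> N" for m n
    using later[of m n] later[of n m] that \<open>\<epsilon> > 0\<close>
    by (cases m n rule: linorder_cases) (auto simp: dist_commute)
  then show "\<exists>M. \<forall>m\<ge>M. \<forall>n\<ge>M. dist (X m) (X n) < \<epsilon>"
    by blast
qed

section \<open>The distance from a point to a set\<close>

lemma kdist_le:
  assumes "e_distance \<kappa>" "y \<in> C"
  shows "kdist \<kappa> x C \<le> \<kappa> x y"
  unfolding kdist_def
  by (rule cINF_lower[OF bdd_belowI2[of _ 0] assms(2)]) (rule e_distance_nonneg[OF assms(1)])

lemma kdist_nonneg:
  assumes "e_distance \<kappa>" "C \<noteq> {}"
  shows "0 \<le> kdist \<kappa> x C"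
  unfolding kdist_def using assms by (auto intro: cINF_greatest e_distance_nonneg)

lemma kdist_triangle:
  assumes \<kappa>: "e_distance \<kappa>" and "C \<noteq> {}"
  shows "kdist \<kappa> x C \<le> \<kappa> x y + kdist \<kappa> y C"
proof -
  have "kdist \<kappa> x C - \<kappa> x y \<le> kdist \<kappa> y C"
    unfolding kdist_def[of \<kappa> y]
  proof (rule cINF_greatest[OF \<open>C \<noteq> {}\<close>])
    fix z assume "z \<in> C"
    then show "kdist \<kappa> x C - \<kappa> x y \<le> \<kappa> y z"
      using kdist_le[OF \<kappa>, of z C x] e_distance_triangle[OF \<kappa>, of x z y] by linarith
  qed
  then show ?thesis by linarith
qed

text \<open>
  Nearly optimal points \<open>y n\<close> of \<open>C\<close> satisfy \<open>\<kappa> (X n) (y n) \<longlonglongrightarrow> 0\<close>, so the third axiom makes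
  them converge to \<open>v\<close> in the metric.
\<close>
lemma kdist_orbit_imp_mem:
  fixes X :: "nat \<Rightarrow> 'a::metric_space"
  assumes \<kappa>: "e_distance \<kappa>"
    and tail: "\<And>n m. n < m \<Longrightarrow> \<kappa> (X n) (X m) \<le> \<gamma> n"
    and \<gamma>: "\<gamma> \<longlonglongrightarrow> 0"
    and X: "X \<longlonglongrightarrow> v"
    and C: "C \<noteq> {}" "closed C"
    and to_C: "(\<lambda>n. kdist \<kappa> (X n) C) \<longlonglongrightarrow> 0"
  shows "v \<in> C"
proof -
  have "\<exists>y\<in>C. \<kappa> (X n) y < kdist \<kappa> (X n) C + inverse (real (Suc n))" for n
    using cInf_lessD[of "\<kappa> (X n) ` C" "kdist \<kappa> (X n) C + inverse (real (Suc n))"] C(1)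
    by (auto simp: kdist_def)
  then obtain y where y: "\<And>n. y n \<in> C"
      "\<And>n. \<kappa> (X n) (y n) < kdist \<kappa> (X n) C + inverse (real (Suc n))"
    by metis
  have "(\<lambda>n. kdist \<kappa> (X n) C + inverse (real (Suc n))) \<longlonglongrightarrow> 0"
    using tendsto_add[OF to_C LIMSEQ_inverse_real_of_nat] by simp
  then have "(\<lambda>n. \<kappa> (X n) (y n)) \<longlonglongrightarrow> 0"
    by (rule tendsto_sandwich[OF _ _ tendsto_const, rotated 2])
      (simp_all add: e_distance_nonneg[OF \<kappa>] less_imp_le[OF y(2)] del: of_nat_Suc)
  then have "(\<lambda>n. dist (X n) (y n)) \<longlonglongrightarrow> 0"
    by (intro e_distance_dist_tendsto_0[OF \<kappa> _ \<gamma>] tail)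
  from tendsto_add[OF this X[unfolded tendsto_dist_iff[of X]]]
  have lim: "(\<lambda>n. dist (X n) (y n) + dist (X n) v) \<longlonglongrightarrow> 0"
    by simp
  have "(\<lambda>n. dist (y n) v) \<longlonglongrightarrow> 0"
    by (rule tendsto_sandwich[OF _ _ tendsto_const lim]) (simp_all add: dist_triangle3)
  then have "y \<longlonglongrightarrow> v"
    by (rule tendsto_dist_iff[THEN iffD2])
  with C(2) y(1) show ?thesis
    by (meson closed_sequentially)
qed

section \<open>Lower semicontinuity along sequences\<close>

text \<open>
  The sequence may visit \<open>v\<close> itself, about which the punctured filter \<open>at v\<close> says nothing. But
  a bound \<open>r < f v\<close> holds at \<open>v\<close> trivially, so lower semicontinuity extends it to a full
  neighbourhood.
\<close>
lemma lower_semicontinuous_limit_le: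
  fixes X :: "nat \<Rightarrow> 'a::topological_space"
  assumes f: "lower_semicontinuous f" and X: "X \<longlonglongrightarrow> v"
    and le: "\<And>n. f (X n) \<le> c n" and c: "c \<longlonglongrightarrow> l"
  shows "f v \<le> l"
proof (rule ccontr)
  assume "\<not> f v \<le> l"
  then obtain r where r: "l < r" "r < f v"
    using dense[of l "f v"] by auto
  have "ereal r < Liminf (at v) (\<lambda>y. ereal (f y))"
    using f r(2) by (auto simp: lower_semicontinuous_def intro: less_le_trans[of _ "ereal (f v)"])
  then have "\<forall>\<^sub>F y in at v. r < f y"
    using less_LiminfD by fastforce
  with r(2) have "\<forall>\<^sub>F y in nhds v. r < f y"
    by (auto simp: eventually_nhds_conv_at)
  with X have "\<forall>\<^sub>F n in sequentially. r < f (X n)"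
    by (auto simp: filterlim_iff)
  moreover have "\<forall>\<^sub>F n in sequentially. c n < r"
    using c r(1) by (rule order_tendstoD)
  ultimately have "\<forall>\<^sub>F n in sequentially. r < f (X n) \<and> c n < r"
    by (rule eventually_conj)
  then obtain n where "r < f (X n)" "c n < r"
    using eventually_happens'[of sequentially] by fastforce
  with le[of n] show False
    by linarith
qed

section \<open>Geometric decay of the step lengths\<close>

lemma MT_function_bounded_near:
  assumes \<mu>: "MT_function \<mu>" and "0 \<le> t"
  obtains q b where "0 < q" "q < 1" "t < b" "\<And>s. \<lbrakk>t \<le> s; s < b\<rbrakk> \<Longrightarrow> \<mu> s \<le> q"
proof -
  have "Limsup (at_right t) (\<lambda>s. ereal (\<mu> s)) < 1"
    using assms by (simp add: MT_function_def)
  then obtain p where p: "Limsup (at_right t) (\<lambda>s. ereal (\<mu> s)) < ereal p" "ereal p < 1"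
    using ereal_dense2 by blast
  then have "\<forall>\<^sub>F s in at_right t. \<mu> s < p"
    using Limsup_lessD by fastforce
  then obtain b where b: "t < b" "\<And>s. \<lbrakk>t < s; s < b\<rbrakk> \<Longrightarrow> \<mu> s < p"
    by (auto simp: eventually_at_right_field)
  \<comment> \<open>The limit superior says nothing about \<open>t\<close> itself, so \<open>\<mu> t\<close> enters separately.\<close>
  show ?thesis
  proof (rule that[of "max (1/2) (max p (\<mu> t))" b])
    show "max (1/2) (max p (\<mu> t)) < 1"
      using p(2) assms by (simp add: MT_function_def)
    show "\<mu> s \<le> max (1/2) (max p (\<mu> t))" if "t \<le> s" "s < b" for s
      using b(2)[of s] that by (cases "s = t") auto
  qed (use b(1) in auto)
qed

text \<open>
  The bound \<open>a (n + 1) \<le> q * a n\<close> is available only from the index \<open>N\<close> on at which \<open>a\<close> has come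
  close to its limit; the factor \<open>q ^ N\<close> in the denominator absorbs the initial terms, which
  are at most \<open>a 0\<close>.
\<close>
lemma MT_contraction_geometric:
  fixes a :: "nat \<Rightarrow> real"
  assumes \<mu>: "MT_function \<mu>"
    and nonneg: "\<And>n. 0 \<le> a n"
    and step: "\<And>n. a (Suc n) \<le> \<mu> (a n) * a n"
  obtains C q where "0 \<le> C" "0 < q" "q < 1" "\<And>n. a n \<le> C * q ^ n"
proof -
  have "a (Suc n) \<le> a n" for n
    using step[of n] mult_right_mono[of "\<mu> (a n)" 1 "a n"] \<mu> nonneg[of n]
    by (auto simp: MT_function_def intro: less_imp_le)
  then have dec: "decseq a"
    by (rule decseq_SucI)
  then obtain t where t: "a \<longlonglongrightarrow> t" "\<And>n. t \<le> a n"
    using decseq_convergent[of a 0] nonneg by metis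
  have "0 \<le> t"
    using LIMSEQ_le_const[OF t(1)] nonneg by blast
  from MT_function_bounded_near[OF \<mu> this] obtain q b
    where q: "0 < q" "q < 1" and b: "t < b" "\<And>s. \<lbrakk>t \<le> s; s < b\<rbrakk> \<Longrightarrow> \<mu> s \<le> q"
    by blast
  from order_tendstoD(2)[OF t(1) b(1)] obtain N where N: "\<And>n. n \<ge> N \<Longrightarrow> a n < b"
    by (auto simp: eventually_sequentially)
  have "a n \<le> a 0 / q ^ N * q ^ n" for n
  proof (induction n)
    case 0
    show ?case
      using q nonneg[of 0] by (simp add: le_divide_eq mult_left_le power_le_one)
  next
    case (Suc n)
    show ?case
    proof (cases "N \<le> n")
      case True
      have "a (Suc n) \<le> \<mu> (a n) * a n"
        by (rule step)
      also have "\<dots> \<le> q * a n"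
        using b(2)[OF t(2) N[OF True]] nonneg by (rule mult_right_mono)
      also have "\<dots> \<le> q * (a 0 / q ^ N * q ^ n)"
        using Suc.IH q(1) by (intro mult_left_mono) auto
      finally show ?thesis
        by (simp add: mult_ac)
    next
      case False
      then have "q ^ N \<le> q ^ Suc n"
        using q by (intro power_decreasing) auto
      then have "a 0 * q ^ N \<le> a 0 * q ^ Suc n"
        using nonneg by (rule mult_left_mono)
      then have "a 0 \<le> a 0 / q ^ N * q ^ Suc n"
        using q(1) by (simp add: field_simps)
      with decseqD[OF dec, of 0 "Suc n"] show ?thesis
        by linarith
    qed
  qed
  moreover have "0 \<le> a 0 / q ^ N"
    using nonneg q(1) by simp
  ultimately show ?thesis
    using that q by blast
qed

lemma geometric_steps_tail:
  fixes X :: "nat \<Rightarrow> 'a::metric_space"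
  assumes \<kappa>: "e_distance \<kappa>" and "0 \<le> C" and q: "0 < q" "q < 1"
    and step: "\<And>n. \<kappa> (X n) (X (Suc n)) \<le> C * q ^ n"
    and "n < m"
  shows "\<kappa> (X n) (X m) \<le> C / (1 - q) * q ^ n"
proof -
  have "\<kappa> (X n) (X (n + Suc k)) \<le> C / (1 - q) * q ^ n" for k n
  proof (induction k arbitrary: n)
    case 0
    have "C \<le> C / (1 - q)"
      using \<open>0 \<le> C\<close> q by (simp add: le_divide_eq mult_left_le)
    then have "C * q ^ n \<le> C / (1 - q) * q ^ n"
      using q by (intro mult_right_mono) auto
    with step[of n] show ?case
      by simp
  next
    case (Suc k)
    have "\<kappa> (X n) (X (n + Suc (Suc k))) \<le> \<kappa> (X n) (X (Suc n)) + \<kappa> (X (Suc n)) (X (Suc n + Suc k))"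
      using e_distance_triangle[OF \<kappa>] by simp
    also have "\<dots> \<le> C * q ^ n + C / (1 - q) * q ^ Suc n"
      using step Suc.IH by (rule add_mono)
    also have "\<dots> = C / (1 - q) * q ^ n"
      using q by (simp add: field_simps)
    finally show ?case .
  qed
  from this[of n "m - Suc n"] \<open>n < m\<close> show ?thesis
    by simp
qed

section \<open>Contractive orbits and their limits\<close>

text \<open>
  The contraction hypothesis relates three consecutive points, so the recursion runs over pairs
  \<open>(x, y)\<close> with \<open>y \<in> T x\<close>.
\<close>
lemma contractive_orbit:
  assumes nonempty: "\<And>x. T x \<noteq> {}"
    and contr: "\<And>x y. y \<in> T x \<Longrightarrow> \<exists>z\<in>T y. \<kappa> y z \<le> \<phi> (\<kappa> x y)"
  obtains X :: "nat \<Rightarrow> 'a" where "\<And>n. X (Suc n) \<in> T (X n)"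
    "\<And>n. \<kappa> (X (Suc n)) (X (Suc (Suc n))) \<le> \<phi> (\<kappa> (X n) (X (Suc n)))"
proof -
  have "\<exists>p. \<forall>n. snd (p n) \<in> T (fst (p n)) \<and>
      (fst (p (Suc n)) = snd (p n) \<and> \<kappa> (snd (p n)) (snd (p (Suc n))) \<le> \<phi> (\<kappa> (fst (p n)) (snd (p n))))"
  proof (rule dependent_nat_choice)
    show "\<exists>p. snd p \<in> T (fst p)"
      using nonempty by (metis all_not_in_conv fst_conv snd_conv)
    show "\<exists>r. snd r \<in> T (fst r) \<and> (fst r = snd p \<and> \<kappa> (snd p) (snd r) \<le> \<phi> (\<kappa> (fst p) (snd p)))"
      if "snd p \<in> T (fst p)" for p :: "'a \<times> 'a" and n :: nat
      using contr[OF that] by (metis fst_conv snd_conv)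
  qed
  then obtain p where p: "\<And>n. snd (p n) \<in> T (fst (p n))" "\<And>n. fst (p (Suc n)) = snd (p n)"
      "\<And>n. \<kappa> (snd (p n)) (snd (p (Suc n))) \<le> \<phi> (\<kappa> (fst (p n)) (snd (p n)))"
    by blast
  show ?thesis
    by (rule that[of "\<lambda>n. fst (p n)"]) (use p in auto)
qed

lemma contractive_orbit_converges:
  fixes X :: "nat \<Rightarrow> 'a::complete_space"
  assumes \<kappa>: "e_distance \<kappa>" and \<mu>: "MT_function \<mu>"
    and step: "\<And>n. \<kappa> (X (Suc n)) (X (Suc (Suc n)))
      \<le> \<mu> (\<kappa> (X n) (X (Suc n))) * \<kappa> (X n) (X (Suc n))"
  obtains \<gamma> v where "\<gamma> \<longlonglongrightarrow> 0" "\<And>n m. n < m \<Longrightarrow> \<kappa> (X n) (X m) \<le> \<gamma> n"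
    "X \<longlonglongrightarrow> v" "\<And>n. \<kappa> (X n) v \<le> \<gamma> n"
proof -
  obtain C q where Cq: "0 \<le> C" "0 < q" "q < 1" "\<And>n. \<kappa> (X n) (X (Suc n)) \<le> C * q ^ n"
    using MT_contraction_geometric[OF \<mu>, of "\<lambda>n. \<kappa> (X n) (X (Suc n))"]
      e_distance_nonneg[OF \<kappa>] step by metis
  \<comment> \<open>The second axiom requires a positive bound, which the summand 1 provides when \<open>C = 0\<close>.\<close>
  define \<gamma> where "\<gamma> n = (C / (1 - q) + 1) * q ^ n" for n
  have pos: "\<gamma> n > 0" for n
    using Cq by (simp add: \<gamma>_def add_nonneg_pos)
  have \<gamma>: "\<gamma> \<longlonglongrightarrow> 0"
    unfolding \<gamma>_def using Cq by (intro tendsto_mult_right_zero LIMSEQ_realpow_zero) auto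
  have tail: "\<kappa> (X n) (X m) \<le> \<gamma> n" if "n < m" for n m
  proof -
    have "C / (1 - q) * q ^ n \<le> \<gamma> n"
      using Cq by (simp add: \<gamma>_def distrib_right)
    with geometric_steps_tail[OF \<kappa> Cq that] show ?thesis
      by linarith
  qed
  obtain v where v: "X \<longlonglongrightarrow> v"
    using Cauchy_convergent[OF e_distance_Cauchy[OF \<kappa> tail \<gamma>]] by (auto simp: convergent_def)
  have "\<kappa> (X n) v \<le> \<gamma> n" for n
    by (rule e_distance_limit_le[OF \<kappa> pos LIMSEQ_ignore_initial_segment[OF v, of "Suc n"]])
      (simp add: tail)
  with that \<gamma> tail v show ?thesis
    by blast
qed

section \<open>Existence of fixed points\<close>

theorem theorem2p1:
  fixes \<kappa> :: "'a::complete_space \<Rightarrow> 'a \<Rightarrow> real"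
    and T :: "'a \<Rightarrow> 'a set"
  assumes "e0_distance \<kappa>"
    and "\<And>x. T x \<noteq> {} \<and> closed (T x)"
    and S1: "\<exists>\<mu>. MT_function \<mu> \<and>
        (\<forall>x. \<forall>y\<in>T x. y \<noteq> x \<longrightarrow> (\<exists>z\<in>T y. \<kappa> y z \<le> \<mu> (\<kappa> x y) * \<kappa> x y))"
    and S2: "closed_multimap T
      \<or> lower_semicontinuous (\<lambda>x. kdist \<kappa> x (T x))
      \<or> lower_semicontinuous (\<lambda>x. infdist x (T x))
      \<or> (\<forall>(x :: nat \<Rightarrow> 'a) v. (\<forall>n. x (Suc n) \<in> T (x n)) \<longrightarrow> x \<longlonglongrightarrow> v \<longrightarrow>
            (\<lambda>n. kdist \<kappa> (x n) (T v)) \<longlonglongrightarrow> 0)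
      \<or> (\<forall>z. z \<notin> fixed_points T \<longrightarrow> (INF x. \<kappa> x z + kdist \<kappa> x (T x)) > 0)"
  shows "fixed_points T \<noteq> {}"
proof
  assume no_fix: "fixed_points T = {}"
  have \<kappa>: "e_distance \<kappa>"
    using assms(1) by (simp add: e0_distance_def)
  have T: "T x \<noteq> {}" "closed (T x)" for x
    using assms(2) by auto
  have moves: "y \<noteq> x" if "y \<in> T x" for x y
    using that no_fix by (auto simp: fixed_points_def)
  obtain \<mu> where \<mu>: "MT_function \<mu>"
    and contr: "\<And>x y. y \<in> T x \<Longrightarrow> \<exists>z\<in>T y. \<kappa> y z \<le> \<mu> (\<kappa> x y) * \<kappa> x y"
    using S1 moves by metis
  obtain X where orbit: "\<And>n. X (Suc n) \<in> T (X n)"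
    and step: "\<And>n. \<kappa> (X (Suc n)) (X (Suc (Suc n)))
      \<le> \<mu> (\<kappa> (X n) (X (Suc n))) * \<kappa> (X n) (X (Suc n))"
    using contractive_orbit[of T \<kappa> "\<lambda>s. \<mu> s * s"] T(1) contr by metis
  obtain \<gamma> v where \<gamma>: "\<gamma> \<longlonglongrightarrow> 0" and tail: "\<And>n m. n < m \<Longrightarrow> \<kappa> (X n) (X m) \<le> \<gamma> n"
    and v: "X \<longlonglongrightarrow> v" and to_v: "\<And>n. \<kappa> (X n) v \<le> \<gamma> n"
    using contractive_orbit_converges[where X = X, OF \<kappa> \<mu> step] by metis
  have v_Suc: "(\<lambda>n. X (Suc n)) \<longlonglongrightarrow> v"
    using v by (rule LIMSEQ_Suc)
  have f_le: "kdist \<kappa> (X n) (T (X n)) \<le> \<gamma> n" for n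
    using kdist_le[OF \<kappa> orbit, of "X n" n] tail[of n "Suc n"] by linarith
  have kdist_imp_mem: "v \<in> T v" if "(\<lambda>n. kdist \<kappa> (X n) (T v)) \<longlonglongrightarrow> 0"
    using kdist_orbit_imp_mem[OF \<kappa> tail \<gamma> v T that] .
  from S2 have "v \<in> T v"
  proof (elim disjE)
    assume "closed_multimap T"
    then have "closed {(x, y). y \<in> T x}"
      by (simp add: closed_multimap_def)
    from closed_sequentially[OF this _ tendsto_Pair[OF v v_Suc]] show ?thesis
      using orbit by simp
  next
    assume "lower_semicontinuous (\<lambda>x. kdist \<kappa> x (T x))"
    from lower_semicontinuous_limit_le[OF this v f_le \<gamma>] have *: "kdist \<kappa> v (T v) \<le> 0" .
    have "kdist \<kappa> (X n) (T v) \<le> \<gamma> n" for n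
      using kdist_triangle[OF \<kappa> T(1), of "X n" v v] * to_v[of n] by linarith
    then have "(\<lambda>n. kdist \<kappa> (X n) (T v)) \<longlonglongrightarrow> 0"
      by (intro tendsto_sandwich[OF _ _ tendsto_const \<gamma>]) (auto simp: kdist_nonneg[OF \<kappa> T(1)])
    then show ?thesis
      by (rule kdist_imp_mem)
  next
    assume lsc: "lower_semicontinuous (\<lambda>x. infdist x (T x))"
    have "(\<lambda>n. dist (X n) (X (Suc n))) \<longlonglongrightarrow> 0"
      using tendsto_dist[OF v v_Suc] by simp
    from lower_semicontinuous_limit_le[OF lsc v infdist_le[OF orbit] this]
    have "infdist v (T v) = 0"
      using infdist_nonneg[of v "T v"] by linarith
    then show ?thesis
      using T by (simp add: in_closed_iff_infdist_zero)
  next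
    assume "\<forall>(x :: nat \<Rightarrow> 'a) v. (\<forall>n. x (Suc n) \<in> T (x n)) \<longrightarrow> x \<longlonglongrightarrow> v \<longrightarrow>
            (\<lambda>n. kdist \<kappa> (x n) (T v)) \<longlonglongrightarrow> 0"
    then show ?thesis
      using orbit v kdist_imp_mem by blast
  next
    assume gap: "\<forall>z. z \<notin> fixed_points T \<longrightarrow> (INF x. \<kappa> x z + kdist \<kappa> x (T x)) > 0"
    have "bdd_below (range (\<lambda>x. \<kappa> x v + kdist \<kappa> x (T x)))"
      by (rule bdd_belowI2[of _ 0]) (simp add: e_distance_nonneg[OF \<kappa>] kdist_nonneg[OF \<kappa> T(1)])
    then have "(INF x. \<kappa> x v + kdist \<kappa> x (T x)) \<le> \<kappa> (X n) v + kdist \<kappa> (X n) (T (X n))" for n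
      by (rule cINF_lower) simp
    then have "(INF x. \<kappa> x v + kdist \<kappa> x (T x)) \<le> \<gamma> n + \<gamma> n" for n
      using to_v[of n] f_le[of n] by (meson add_mono order_trans)
    moreover have "(\<lambda>n. \<gamma> n + \<gamma> n) \<longlonglongrightarrow> 0"
      using tendsto_add[OF \<gamma> \<gamma>] by simp
    ultimately have "(INF x. \<kappa> x v + kdist \<kappa> x (T x)) \<le> 0"
      using LIMSEQ_le_const by blast
    with gap show ?thesis
      by (force simp: fixed_points_def)
  qed
  with no_fix show False
    by (auto simp: fixed_points_def)
qed

end
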